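(* Let $H(x)=-x\log_2 x-(1-x)\log_2(1-x)$ be the binary entropy function, let $\lambda\in(0,\tfrac12)$ be the solution of the equation $\lambda+H(\lambda)=1$, and let $c$ satisfy $\lambda<c<\tfrac12$. Then $m(n)\le 2^{H(c)n}$ for all sufficiently large $n$. In particular, for any $c$ with $\lambda<c<\tfrac12$ we have $m(n)=O\left(2^{H(c)n}\right)$ as $n\to\infty$.
   Context: A comparative probability order on $X=[n]=\{1,\dots,n\}$ is a linear order $\preceq$ on the power set $2^{X}$ (strict part $\prec$) such that $\emptyset\prec A$ for every nonempty $A\subseteq X$, and $A\preceq B\iff A\cup C\preceq B\cup C$ for all $A,B,C\subseteq X$ with $(A\cup B)\cap C=\emptyset$. It is representable if there is a probability measure $(p_1,\dots,p_n)$ on $X$ such that $A\preceq B\iff\sum_{i\in A}p_i\le\sum_{i\in B}p_i$ for all $A,B\subseteq X$. Two subsets $A\prec B$ are adjacent if there is no $C\subseteq X$ with $A\prec C\prec B$. A pair $(A,B)$ of disjoint subsets of $X$ is critical for $\preceq$ if $A\prec B$ and $A,B$ are adjacent. A critical pair $(A,B)$ is flippable for $\preceq$ if for every $D\subseteq X$ disjoint from $A\cup B$ the sets $A\cup D$ and $B\cup D$ are adjacent in $\preceq$. $m(n)$ denotes the maximal number of flippable pairs of a representable comparative probability order on $[n]$. *)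

theory Defs
  imports Complex_Main "HOL-Library.Landau_Symbols"
begin

definition binary_entropy :: "real \<Rightarrow> real" where
  "binary_entropy x = - x * log 2 x - (1 - x) * log 2 (1 - x)"

(* An order R is a set of pairs: (A, B) \<in> R reads "A is weakly below B". *)

definition strictly_below :: "'a rel \<Rightarrow> 'a \<Rightarrow> 'a \<Rightarrow> bool" where
  "strictly_below R a b \<longleftrightarrow> (a, b) \<in> R \<and> a \<noteq> b"

definition comparative_probability_order :: "nat \<Rightarrow> nat set rel \<Rightarrow> bool" where
  "comparative_probability_order n R \<longleftrightarrow>
     linear_order_on (Pow {1..n}) R \<and>
     (\<forall>A. A \<subseteq> {1..n} \<and> A \<noteq> {} \<longrightarrow> strictly_below R {} A) \<and>
     (\<forall>A B C. A \<subseteq> {1..n} \<and> B \<subseteq> {1..n} \<and> C \<subseteq> {1..n} \<and> (A \<union> B) \<inter> C = {} \<longrightarrow>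
        ((A, B) \<in> R \<longleftrightarrow> (A \<union> C, B \<union> C) \<in> R))"

definition representable :: "nat \<Rightarrow> nat set rel \<Rightarrow> bool" where
  "representable n R \<longleftrightarrow>
     (\<exists>p :: nat \<Rightarrow> real. (\<forall>i\<in>{1..n}. p i \<ge> 0) \<and> (\<Sum>i=1..n. p i) = 1 \<and>
        (\<forall>A B. A \<subseteq> {1..n} \<and> B \<subseteq> {1..n} \<longrightarrow>
           ((A, B) \<in> R \<longleftrightarrow> (\<Sum>i\<in>A. p i) \<le> (\<Sum>i\<in>B. p i))))"

definition adjacent :: "nat \<Rightarrow> nat set rel \<Rightarrow> nat set \<Rightarrow> nat set \<Rightarrow> bool" where
  "adjacent n R A B \<longleftrightarrow>
     A \<subseteq> {1..n} \<and> B \<subseteq> {1..n} \<and> strictly_below R A B \<and>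
     \<not> (\<exists>C. C \<subseteq> {1..n} \<and> strictly_below R A C \<and> strictly_below R C B)"

definition critical_pair :: "nat \<Rightarrow> nat set rel \<Rightarrow> nat set \<Rightarrow> nat set \<Rightarrow> bool" where
  "critical_pair n R A B \<longleftrightarrow>
     A \<subseteq> {1..n} \<and> B \<subseteq> {1..n} \<and> A \<inter> B = {} \<and> strictly_below R A B \<and> adjacent n R A B"

definition flippable_pair :: "nat \<Rightarrow> nat set rel \<Rightarrow> nat set \<Rightarrow> nat set \<Rightarrow> bool" where
  "flippable_pair n R A B \<longleftrightarrow>
     critical_pair n R A B \<and>
     (\<forall>D. D \<subseteq> {1..n} \<and> D \<inter> (A \<union> B) = {} \<longrightarrow> adjacent n R (A \<union> D) (B \<union> D))"

(* For n = 0 there is no representable order (no probability measure on the empty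
   set), and the value of Max is unspecified. *)
definition max_flippable :: "nat \<Rightarrow> nat" where
  "max_flippable n =
     Max {card {(A, B). flippable_pair n R A B} | R.
            comparative_probability_order n R \<and> representable n R}"

lemma ex1_entropy_threshold:
  "\<exists>!x. 0 < x \<and> x < 1/2 \<and> x + binary_entropy x = 1"
proof -
  define f where "f = (\<lambda>x. x + binary_entropy x)"
  have deriv: "(f has_real_derivative (1 + log 2 (1 - x) - log 2 x)) (at x)"
    if "0 < x" "x < 1" for x
  proof -
    have eq: "f = (\<lambda>x. x - (x * ln x + (1 - x) * ln (1 - x)) / ln 2)"
      by (auto simp: f_def binary_entropy_def log_def add_divide_distrib)
    show ?thesis
      unfolding eq
      by (rule derivative_eq_intros refl | use that in \<open>simp add: log_def diff_divide_distrib\<close>)+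
  qed
  have mono: "f x < f y" if "0 < x" "x < y" "y \<le> 1/2" for x y
  proof (rule DERIV_pos_imp_increasing_open[OF that(2)])
    show "\<exists>d. (f has_real_derivative d) (at z) \<and> 0 < d" if "x < z" "z < y" for z
    proof (intro exI conjI)
      show "(f has_real_derivative (1 + log 2 (1 - z) - log 2 z)) (at z)"
        using that \<open>0 < x\<close> \<open>y \<le> 1/2\<close> by (intro deriv) auto
      have "log 2 z < log 2 (1 - z)"
        using that \<open>0 < x\<close> \<open>y \<le> 1/2\<close> by simp
      then show "0 < 1 + log 2 (1 - z) - log 2 z" by simp
    qed
    show "continuous_on {x..y} f"
    proof (intro continuous_at_imp_continuous_on ballI)
      fix z assume "z \<in> {x..y}"
      then show "isCont f z"
        using \<open>0 < x\<close> \<open>y \<le> 1/2\<close> by (intro DERIV_isCont[OF deriv]) auto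
    qed
  qed
  have log8: "log 2 8 = (3 :: real)"
    using log_pow_cancel[of "2::real" 3] by simp
  have "log 2 ((8/7) ^ 2) < log 2 (2::real)"
    by (subst log_less_cancel_iff) (auto simp: power2_eq_square)
  then have l78: "log 2 (8/7) < (1/2 :: real)"
    by (simp add: log_nat_power)
  have "f (1/8) = 1/8 + 1/8 * log 2 8 + 7/8 * log 2 (8/7)"
    by (simp add: f_def binary_entropy_def log_divide field_simps)
  then have lo: "f (1/8) < 1"
    using l78 by (simp add: log8)
  have hi: "f (1/2) = 3/2"
    by (simp add: f_def binary_entropy_def log_divide)
  have "\<exists>x. 1/8 \<le> x \<and> x \<le> 1/2 \<and> f x = 1"
  proof (rule IVT)
    show "\<forall>x. 1/8 \<le> x \<and> x \<le> 1/2 \<longrightarrow> isCont f x"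
      by (intro allI impI DERIV_isCont[OF deriv]) auto
  qed (use lo hi in auto)
  then obtain x where x: "1/8 \<le> x" "x \<le> 1/2" "f x = 1" by blast
  have "x \<noteq> 1/2"
  proof
    assume "x = 1/2"
    with x(3) hi have "1 = (3/2 :: real)" by (simp only:)
    then show False by simp
  qed
  have unique: "y = x" if "0 < y" "y < 1/2" "f y = 1" for y
    using mono[of x y] mono[of y x] that x by (cases x y rule: linorder_cases) auto
  show ?thesis
  proof (rule ex1I[of _ x])
    show "0 < x \<and> x < 1/2 \<and> x + binary_entropy x = 1"
      using x \<open>x \<noteq> 1/2\<close> by (auto simp: f_def)
  next
    fix y :: real assume "0 < y \<and> y < 1/2 \<and> y + binary_entropy y = 1"
    then show "y = x" by (intro unique) (auto simp: f_def)
  qed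
qed

end

theory Submission
  imports Defs "HOL-Library.Nat_Bijection"
begin

text \<open>
  Flippable pairs of a representable order are counted in two ways. On the one hand, each flippable
  pair \<open>(A, B)\<close> produces \<open>2 ^ (n - |A \<union> B|)\<close> adjacencies \<open>(A \<union> D, B \<union> D)\<close>, and distinct triples
  \<open>(A, B, D)\<close> produce distinct lower sets \<open>A \<union> D\<close>; hence at most \<open>2 powr ((1 - x) n)\<close> flippable pairs
  satisfy \<open>|A \<union> B| \<le> (1 - x) n\<close>. On the other hand, a flippable pair is determined by \<open>A \<union> B\<close>,
  since if \<open>A \<union> B = A' \<union> B'\<close> and \<open>A\<close> is lighter than \<open>A'\<close>, then \<open>A'\<close> lies strictly between \<open>A\<close> and
  \<open>B\<close>; hence at most \<open>2 powr (H(x) n)\<close> flippable pairs satisfy \<open>|A \<union> B| > (1 - x) n\<close>. For \<open>l < x < c\<close> we have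
  \<open>1 - x < H(x) < H(c)\<close>.
\<close>

section \<open>Binary entropy and tails of binomial sums\<close>

lemma binary_entropy_strict_mono:
  assumes "0 < x" "x < y" "y \<le> 1/2"
  shows "binary_entropy x < binary_entropy y"
proof (rule DERIV_pos_imp_increasing_open[OF assms(2)])
  have eq: "binary_entropy = (\<lambda>x. - (x * ln x + (1 - x) * ln (1 - x)) / ln 2)"
    by (auto simp: binary_entropy_def log_def add_divide_distrib diff_divide_distrib)
  have deriv: "(binary_entropy has_real_derivative (log 2 (1 - z) - log 2 z)) (at z)"
    if "0 < z" "z < 1" for z
    unfolding eq
    by (rule derivative_eq_intros refl | use that in \<open>simp add: log_def diff_divide_distrib\<close>)+
  show "\<exists>d. (binary_entropy has_real_derivative d) (at z) \<and> 0 < d" if "x < z" "z < y" for z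
    using that assms by (intro exI[of _ "log 2 (1 - z) - log 2 z"] conjI deriv) auto
  show "continuous_on {x..y} binary_entropy"
    by (intro continuous_at_imp_continuous_on ballI DERIV_isCont[OF deriv]) (use assms in auto)
qed

text \<open>The terms \<open>(n choose j) * x ^ j * (1 - x) ^ (n - j)\<close> add up to
  \<open>(x + (1 - x)) ^ n = 1\<close>. Since \<open>x \<le> 1 - x\<close>, the weight
  \<open>x ^ j * (1 - x) ^ (n - j)\<close> decreases in \<open>j\<close>, and at
  \<open>j = x * n\<close> it would equal \<open>q\<close>.\<close>

lemma sum_binomial_le_entropy:
  assumes "0 < x" "x \<le> 1/2" "finite J" "\<And>j. j \<in> J \<Longrightarrow> j \<le> n \<and> real j \<le> x * real n"
  shows "(\<Sum>j\<in>J. real (n choose j)) \<le> 2 powr (binary_entropy x * real n)"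
proof -
  define q where "q = 2 powr (- binary_entropy x * real n)"
  have term_ge: "q \<le> x ^ j * (1 - x) ^ (n - j)" if "j \<in> J" for j
  proof -
    have j: "j \<le> n" "real j \<le> x * real n" using assms(4)[OF that] by auto
    \<comment> \<open>This product is exactly the right side minus the left side of the next
      inequality.\<close>
    have "0 \<le> (x * real n - real j) * (log 2 (1 - x) - log 2 x)"
      using j assms by (intro mult_nonneg_nonneg) auto
    then have "- binary_entropy x * real n
        \<le> real j * log 2 x + (real n - real j) * log 2 (1 - x)"
      by (simp add: binary_entropy_def algebra_simps)
    then have "q \<le> 2 powr (real j * log 2 x + (real n - real j) * log 2 (1 - x))"
      by (simp add: q_def)
    also have "\<dots> = x powr real j * (1 - x) powr (real n - real j)"
      using assms by (simp add: powr_add powr_powr[symmetric] mult.commute[of _ "log _ _"])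
    also have "\<dots> = x ^ j * (1 - x) ^ (n - j)"
      using assms j by (simp add: powr_realpow flip: of_nat_diff)
    finally show ?thesis .
  qed
  have "(\<Sum>j\<in>J. real (n choose j)) * q \<le> (\<Sum>j\<in>J. real (n choose j) * (x ^ j * (1 - x) ^ (n - j)))"
    unfolding sum_distrib_right using term_ge by (intro sum_mono mult_left_mono) auto
  also have "\<dots> \<le> (\<Sum>j\<le>n. real (n choose j) * (x ^ j * (1 - x) ^ (n - j)))"
    using assms by (intro sum_mono2) auto
  also have "\<dots> = (x + (1 - x)) ^ n"
    by (subst binomial_ring) (simp add: mult.assoc)
  finally have "(\<Sum>j\<in>J. real (n choose j)) * q \<le> 1" by simp
  then show ?thesis
    by (simp add: q_def powr_minus divide_simps)
qed

text \<open>Complementation turns large sets into small ones: \<open>j\<close> below is the size of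
  the complement, which is at most \<open>x * n\<close>.\<close>

lemma card_subsets_large_le_entropy:
  assumes "0 < x" "x \<le> 1/2"
  shows "real (card {S. S \<subseteq> {1..n} \<and> (1 - x) * real n < real (card S)})
           \<le> 2 powr (binary_entropy x * real n)"
proof -
  define J where "J = {j. j \<le> n \<and> real j \<le> x * real n}"
  have fin: "finite J" unfolding J_def by simp
  have card_le: "card S \<le> n" if "S \<subseteq> {1..n}" for S
    using card_mono[OF _ that] by simp
  have "card {S. S \<subseteq> {1..n} \<and> (1 - x) * real n < real (card S)}
      \<le> card (\<Union>j\<in>J. {S. S \<subseteq> {1..n} \<and> card S = n - j})"
  proof (intro card_mono subsetI)
    fix S assume S: "S \<in> {S. S \<subseteq> {1..n} \<and> (1 - x) * real n < real (card S)}"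
    then have "n - card S \<in> J" "card S = n - (n - card S)"
      using card_le[of S] by (auto simp: J_def of_nat_diff algebra_simps)
    with S show "S \<in> (\<Union>j\<in>J. {S. S \<subseteq> {1..n} \<and> card S = n - j})" by blast
  qed (use fin in auto)
  also have "\<dots> \<le> (\<Sum>j\<in>J. card {S. S \<subseteq> {1..n} \<and> card S = n - j})"
    by (rule card_UN_le[OF fin])
  also have "\<dots> = (\<Sum>j\<in>J. n choose j)"
    by (intro sum.cong refl) (auto simp: n_subsets J_def binomial_symmetric[symmetric])
  finally have "real (card {S. S \<subseteq> {1..n} \<and> (1 - x) * real n < real (card S)})
      \<le> (\<Sum>j\<in>J. real (n choose j))"
    by (simp flip: of_nat_sum)
  also have "\<dots> \<le> 2 powr (binary_entropy x * real n)"
    using assms fin by (intro sum_binomial_le_entropy) (auto simp: J_def)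
  finally show ?thesis .
qed

section \<open>Counting flippable pairs of one order\<close>

lemma adjacent_upper_unique:
  assumes "linear_order_on (Pow {1..n}) R" "adjacent n R A B" "adjacent n R A C"
  shows "B = C"
proof (rule ccontr)
  assume "B \<noteq> C"
  moreover have "B \<in> Pow {1..n}" "C \<in> Pow {1..n}"
    using assms by (auto simp: adjacent_def)
  ultimately have "(B, C) \<in> R \<or> (C, B) \<in> R"
    using assms(1) unfolding linear_order_on_def total_on_def by blast
  \<comment> \<open>Whichever of \<open>B\<close> and \<open>C\<close> is lower lies strictly
    between \<open>A\<close> and the other.\<close>
  with \<open>B \<noteq> C\<close> show False
    using assms(2,3) unfolding adjacent_def strictly_below_def by blast
qed

lemma finite_flippable_pairs: "finite {(A, B). flippable_pair n R A B}"
  by (rule finite_subset[of _ "Pow {1..n} \<times> Pow {1..n}"])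
    (auto simp: flippable_pair_def critical_pair_def)

text \<open>The summand counts the sets \<open>D\<close> disjoint from \<open>A \<union> B\<close>,
  and each gives an adjacency whose lower set is one of the \<open>2 ^ n\<close> subsets.
  Injectivity holds because a lower set determines its upper neighbour.\<close>

lemma sum_flippable_pairs_le:
  assumes "linear_order_on (Pow {1..n}) R"
  shows "(\<Sum>(A, B)\<in>{(A, B). flippable_pair n R A B}. (2::nat) ^ (n - card (A \<union> B))) \<le> 2 ^ n"
proof -
  define F where "F = {(A, B). flippable_pair n R A B}"
  define T where "T = (SIGMA P:F. Pow ({1..n} - (fst P \<union> snd P)))"
  have inj: "inj_on (\<lambda>(P, D). fst P \<union> D) T"
  proof (rule inj_onI, clarify)
    fix A B D A' B' D'
    assume T: "((A, B), D) \<in> T" "((A', B'), D') \<in> T"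
      and "fst (A, B) \<union> D = fst (A', B') \<union> D'"
    then have eq: "A \<union> D = A' \<union> D'" by simp
    have flip: "adjacent n R (A \<union> D) (B \<union> D)" "adjacent n R (A' \<union> D') (B' \<union> D')"
      using T by (auto simp: T_def F_def flippable_pair_def)
    have "B \<union> D = B' \<union> D'"
      using adjacent_upper_unique[OF assms] flip eq by metis
    moreover have "A \<inter> B = {}" "A' \<inter> B' = {}" "D \<inter> (A \<union> B) = {}" "D' \<inter> (A' \<union> B') = {}"
      using T by (auto simp: T_def F_def flippable_pair_def critical_pair_def)
    \<comment> \<open>As \<open>A\<close> and \<open>B\<close> are disjoint, \<open>D\<close> is the
      intersection of \<open>A \<union> D\<close> and \<open>B \<union> D\<close>; removing it
      leaves \<open>A\<close> and \<open>B\<close>.\<close>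
    ultimately have "A = A' \<and> B = B' \<and> D = D'"
      using eq by blast
    then show "(A, B) = (A', B') \<and> D = D'" by simp
  qed
  have sub: "(\<lambda>(P, D). fst P \<union> D) ` T \<subseteq> Pow {1..n}"
    by (auto simp: T_def F_def flippable_pair_def critical_pair_def)
  have card_Diff: "card ({1..n} - (fst P \<union> snd P)) = n - card (fst P \<union> snd P)" if "P \<in> F" for P
  proof -
    have "fst P \<union> snd P \<subseteq> {1..n}"
      using that by (auto simp: F_def flippable_pair_def critical_pair_def)
    from card_Diff_subset[OF finite_subset[OF this finite_atLeastAtMost] this]
    show ?thesis by simp
  qed
  have "finite F" unfolding F_def by (rule finite_flippable_pairs)
  then have "card T = (\<Sum>P\<in>F. card (Pow ({1..n} - (fst P \<union> snd P))))"
    unfolding T_def by (intro card_SigmaI) auto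
  also have "\<dots> = (\<Sum>P\<in>F. 2 ^ (n - card (fst P \<union> snd P)))"
    by (intro sum.cong refl) (simp only: card_Pow finite_Diff finite_atLeastAtMost card_Diff)
  finally have "(\<Sum>(A, B)\<in>F. (2::nat) ^ (n - card (A \<union> B))) = card T"
    by (simp add: case_prod_unfold)
  also have "\<dots> \<le> card (Pow {1..n})"
    by (rule card_inj_on_le[OF inj sub]) simp
  finally show ?thesis by (simp add: F_def card_Pow)
qed

lemma flippable_pair_union_inject:
  assumes "representable n R" "linear_order_on (Pow {1..n}) R"
    and "flippable_pair n R A B" "flippable_pair n R A' B'" "A \<union> B = A' \<union> B'"
  shows "A = A' \<and> B = B'"
proof -
  obtain p :: "nat \<Rightarrow> real" where
    rep: "\<forall>A B. A \<subseteq> {1..n} \<and> B \<subseteq> {1..n} \<longrightarrow> ((A, B) \<in> R \<longleftrightarrow> sum p A \<le> sum p B)"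
    using assms(1) unfolding representable_def by (elim exE conjE)
  have p: "(X, Y) \<in> R \<longleftrightarrow> sum p X \<le> sum p Y" if "X \<subseteq> {1..n}" "Y \<subseteq> {1..n}" for X Y
    using rep that by simp
  \<comment> \<open>Antisymmetry of \<open>R\<close> excludes ties, so the strict order is strict
    inequality of weights.\<close>
  have anti: "X = Y" if "X \<subseteq> {1..n}" "Y \<subseteq> {1..n}" "sum p X = sum p Y" for X Y
  proof (rule antisymD)
    show "antisym R" using assms(2) by (simp add: linear_order_on_def partial_order_on_def)
  qed (use that p in simp_all)
  have below: "strictly_below R X Y \<longleftrightarrow> sum p X < sum p Y"
    if "X \<subseteq> {1..n}" "Y \<subseteq> {1..n}" for X Y
    using p[OF that] anti[OF that] unfolding strictly_below_def less_le by blast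
  have facts: "X \<subseteq> {1..n} \<and> Y \<subseteq> {1..n} \<and> X \<inter> Y = {} \<and> sum p X < sum p Y
      \<and> sum p X + sum p Y = sum p (X \<union> Y)
      \<and> \<not> (\<exists>Z. Z \<subseteq> {1..n} \<and> sum p X < sum p Z \<and> sum p Z < sum p Y)"
    if "flippable_pair n R X Y" for X Y
  proof -
    have XY: "X \<subseteq> {1..n}" "Y \<subseteq> {1..n}" "X \<inter> Y = {}" "strictly_below R X Y" "adjacent n R X Y"
      using that by (auto simp: flippable_pair_def critical_pair_def)
    then have "sum p X + sum p Y = sum p (X \<union> Y)"
      using finite_subset[of X "{1..n}"] finite_subset[of Y "{1..n}"]
      by (simp add: sum.union_disjoint)
    moreover have "\<not> (\<exists>Z. Z \<subseteq> {1..n} \<and> sum p X < sum p Z \<and> sum p Z < sum p Y)"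
      using XY(5) below[OF XY(1)] below[OF _ XY(2)] unfolding adjacent_def by metis
    ultimately show ?thesis using XY below[OF XY(1,2)] by simp
  qed
  note f = facts[OF assms(3)] and f' = facts[OF assms(4)]
  have total: "sum p A + sum p B = sum p A' + sum p B'"
    using f f' by (simp only: assms(5))
  \<comment> \<open>With equal totals, a heavier lower set forces a lighter upper set:
    \<open>sum p A < sum p A' < sum p B' < sum p B\<close>.\<close>
  have "sum p A' < sum p B" if "sum p A < sum p A'"
    using f f' total that by linarith
  then have "\<not> sum p A < sum p A'" using f f' by blast
  moreover have "sum p A < sum p B'" if "sum p A' < sum p A"
    using f f' total that by linarith
  then have "\<not> sum p A' < sum p A" using f f' by blast
  ultimately have "A = A'" using f f' by (intro anti) auto
  moreover have "A \<inter> B = {}" "A' \<inter> B' = {}" using f f' by simp_all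
  ultimately show ?thesis using assms(5) by blast
qed

lemma card_flippable_pairs_le:
  assumes "representable n R" "linear_order_on (Pow {1..n}) R" "0 < x" "x \<le> 1/2"
  shows "real (card {(A, B). flippable_pair n R A B})
           \<le> 2 powr ((1 - x) * real n) + 2 powr (binary_entropy x * real n)"
proof -
  define F where "F = {(A, B). flippable_pair n R A B}"
  define S where "S = {P \<in> F. real (card (fst P \<union> snd P)) \<le> (1 - x) * real n}"
  define L where "L = {P \<in> F. (1 - x) * real n < real (card (fst P \<union> snd P))}"
  have fin: "finite F" unfolding F_def by (rule finite_flippable_pairs)
  have sub: "fst P \<union> snd P \<subseteq> {1..n}" if "P \<in> F" for P
    using that by (auto simp: F_def flippable_pair_def critical_pair_def)

  \<comment> \<open>Each pair in \<open>S\<close> contributes at least \<open>2 powr (x * n)\<close>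
    to a sum that is at most \<open>2 ^ n\<close>.\<close>
  have "real (card S) * 2 powr (x * real n) = (\<Sum>P\<in>S. 2 powr (x * real n))"
    by simp
  also have "\<dots> \<le> (\<Sum>P\<in>S. 2 ^ (n - card (fst P \<union> snd P)))"
  proof (rule sum_mono)
    fix P assume "P \<in> S"
    then have "x * real n \<le> real n - real (card (fst P \<union> snd P))" "card (fst P \<union> snd P) \<le> n"
      using card_mono[OF _ sub[of P]] by (auto simp: S_def algebra_simps)
    then have "x * real n \<le> real (n - card (fst P \<union> snd P))" by (simp add: of_nat_diff)
    then have "2 powr (x * real n) \<le> 2 powr real (n - card (fst P \<union> snd P))" by simp
    then show "2 powr (x * real n) \<le> 2 ^ (n - card (fst P \<union> snd P))"
      by (simp add: powr_realpow)
  qed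
  also have "\<dots> \<le> (\<Sum>P\<in>F. 2 ^ (n - card (fst P \<union> snd P)))"
    using fin by (intro sum_mono2) (auto simp: S_def)
  also have "\<dots> = real (\<Sum>(A, B)\<in>F. 2 ^ (n - card (A \<union> B)))"
    by (simp add: case_prod_unfold)
  also have "\<dots> \<le> real (2 ^ n)"
    using sum_flippable_pairs_le[OF assms(2)] unfolding F_def of_nat_le_iff .
  finally have "real (card S) \<le> 2 powr real n / 2 powr (x * real n)"
    by (simp add: field_simps powr_realpow)
  then have small: "real (card S) \<le> 2 powr ((1 - x) * real n)"
    by (simp add: left_diff_distrib flip: powr_diff)

  have inj: "inj_on (\<lambda>P. fst P \<union> snd P) L"
    using flippable_pair_union_inject[OF assms(1,2)]
    by (auto simp: inj_on_def L_def F_def)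
  have "card L \<le> card {S. S \<subseteq> {1..n} \<and> (1 - x) * real n < real (card S)}"
    by (rule card_inj_on_le[OF inj]) (use sub in \<open>auto simp: L_def\<close>)
  then have large: "real (card L) \<le> 2 powr (binary_entropy x * real n)"
    using card_subsets_large_le_entropy[OF assms(3,4), of n] by linarith

  have "F = S \<union> L" by (auto simp: S_def L_def)
  then have "card F \<le> card S + card L" by (simp add: card_Un_le)
  with small large show ?thesis unfolding F_def by linarith
qed

section \<open>Well-definedness of the maximum and the asymptotic bound\<close>

text \<open>This makes the set under \<open>Max\<close> nonempty. Weights proportional to
  \<open>2 ^ i\<close> work, since binary expansions are unique and distinct subsets therefore get
  distinct weights.\<close>

lemma representable_order_exists:
  assumes "0 < n"
  shows "\<exists>R. comparative_probability_order n R \<and> representable n R"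
proof -
  define N where "N = (\<Sum>i=1..n. (2::real) ^ i)"
  define p where "p i = 2 ^ i / N" for i
  define R where "R = {(A, B). A \<subseteq> {1..n} \<and> B \<subseteq> {1..n} \<and> sum p A \<le> sum p B}"
  have N: "0 < N" unfolding N_def using assms by (intro sum_pos) auto
  \<comment> \<open>For infinite \<open>A\<close> both sides are 0, the default value of a
    sum.\<close>
  have sum_p: "sum p A = real (set_encode A) / N" for A
    by (simp add: p_def set_encode_def sum_divide_distrib)
  have inj: "A = B" if "A \<subseteq> {1..n}" "B \<subseteq> {1..n}" "sum p A = sum p B" for A B
  proof (rule inj_onD[OF inj_on_set_encode])
    show "set_encode A = set_encode B" using that N by (simp add: sum_p)
  qed (use that finite_subset[of _ "{1..n}"] in auto)
  have "antisym R"
    by (intro antisymI inj) (auto simp: R_def)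
  then have "linear_order_on (Pow {1..n}) R"
    unfolding linear_order_on_def partial_order_on_def preorder_on_def
    by (auto simp: R_def refl_on_def trans_def total_on_def)
  moreover have "strictly_below R {} A" if "A \<subseteq> {1..n}" "A \<noteq> {}" for A
    using that N by (auto simp: strictly_below_def R_def p_def intro!: sum_nonneg)
  moreover have "(A, B) \<in> R \<longleftrightarrow> (A \<union> C, B \<union> C) \<in> R"
    if "A \<subseteq> {1..n}" "B \<subseteq> {1..n}" "C \<subseteq> {1..n}" "(A \<union> B) \<inter> C = {}" for A B C
  proof -
    have "sum p (X \<union> C) = sum p X + sum p C" if "X \<subseteq> A \<union> B" for X
    proof (rule sum.union_disjoint)
      show "finite X" "finite C"
        using that \<open>A \<subseteq> _\<close> \<open>B \<subseteq> _\<close> \<open>C \<subseteq> _\<close>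
        by (meson Un_least finite_atLeastAtMost finite_subset order_trans)+
    qed (use that \<open>(A \<union> B) \<inter> C = {}\<close> in blast)
    then show ?thesis using that by (simp add: R_def)
  qed
  ultimately have "comparative_probability_order n R"
    unfolding comparative_probability_order_def by blast
  moreover have "representable n R"
    unfolding representable_def
  proof (intro exI conjI)
    show "\<forall>i\<in>{1..n}. 0 \<le> p i" using N by (simp add: p_def)
    show "sum p {1..n} = 1" using N by (simp add: p_def N_def flip: sum_divide_distrib)
  qed (simp add: R_def)
  ultimately show ?thesis by blast
qed

lemma max_flippable_le:
  assumes "0 < n" "0 < x" "x \<le> 1/2"
  shows "real (max_flippable n) \<le> 2 powr ((1 - x) * real n) + 2 powr (binary_entropy x * real n)"
proof -
  define M where "M = {card {(A, B). flippable_pair n R A B} | R.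
            comparative_probability_order n R \<and> representable n R}"
  define b where "b = 2 powr ((1 - x) * real n) + 2 powr (binary_entropy x * real n)"
  have le: "real m \<le> b" if "m \<in> M" for m
    using that card_flippable_pairs_le[OF _ _ assms(2,3)]
    by (auto simp: M_def b_def comparative_probability_order_def)
  \<comment> \<open>The bound, being uniform in \<open>R\<close>, also gives the finiteness that
    \<open>Max_in\<close> requires.\<close>
  have "M \<subseteq> {..nat \<lfloor>b\<rfloor>}"
    using le by (auto simp: le_nat_floor)
  then have "finite M" by (rule finite_subset) simp
  moreover have "M \<noteq> {}"
    using representable_order_exists[OF assms(1)] by (auto simp: M_def)
  ultimately have "Max M \<in> M" by (rule Max_in)
  then show ?thesis
    using le by (simp add: max_flippable_def M_def b_def)
qed

theorem corollary2:
  fixes l c :: real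
  assumes "0 < l" and "l < 1/2" and "l + binary_entropy l = 1"
    and "l < c" and "c < 1/2"
  shows "(\<forall>\<^sub>F n in sequentially.
            real (max_flippable n) \<le> 2 powr (binary_entropy c * real n))
       \<and> (\<lambda>n. real (max_flippable n)) \<in> O(\<lambda>n. 2 powr (binary_entropy c * real n))"
proof -
  \<comment> \<open>Any point strictly between \<open>l\<close> and \<open>c\<close> serves:
    \<open>l < x\<close> gives \<open>1 - x < 1 - l = binary_entropy l < binary_entropy x\<close>,
    and \<open>x < c\<close> leaves room for a constant factor.\<close>
  define x where "x = (l + c) / 2"
  have x: "0 < x" "x \<le> 1/2" "l < x" "x < c" using assms by (auto simp: x_def)
  have Hl: "binary_entropy l < binary_entropy x" and Hc: "binary_entropy x < binary_entropy c"
    using assms x by (auto intro!: binary_entropy_strict_mono)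
  \<comment> \<open>From \<open>k\<close> on, the exponents for \<open>c\<close> and
    \<open>x\<close> differ by at least 1, which absorbs the factor 2 from adding the two
    bounds.\<close>
  obtain k :: nat where k: "1 / (binary_entropy c - binary_entropy x) < real k"
    using reals_Archimedean2 by blast
  have bound: "real (max_flippable n) \<le> 2 powr (binary_entropy c * real n)"
    if n: "n \<ge> max 1 k" for n
  proof -
    have "1 / (binary_entropy c - binary_entropy x) < real n" using n k by simp
    then have gap: "1 + binary_entropy x * real n \<le> binary_entropy c * real n"
      using Hc by (simp add: field_simps)
    have "real (max_flippable n) \<le> 2 powr ((1 - x) * real n) + 2 powr (binary_entropy x * real n)"
      using n x by (intro max_flippable_le) auto
    also have "\<dots> \<le> 2 powr (binary_entropy x * real n) + 2 powr (binary_entropy x * real n)"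
      using Hl x assms by (intro add_right_mono powr_mono mult_right_mono) auto
    also have "\<dots> = 2 powr (1 + binary_entropy x * real n)"
      by (simp add: powr_add)
    also have "\<dots> \<le> 2 powr (binary_entropy c * real n)" using gap by simp
    finally show ?thesis .
  qed
  then have ev: "\<forall>\<^sub>F n in sequentially. real (max_flippable n) \<le> 2 powr (binary_entropy c * real n)"
    using eventually_ge_at_top by (rule eventually_mono[rotated])
  moreover from ev have "(\<lambda>n. real (max_flippable n)) \<in> O(\<lambda>n. 2 powr (binary_entropy c * real n))"
    by (intro bigoI[of _ 1]) (auto elim: eventually_mono)
  ultimately show ?thesis by blast
qed

end
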